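(* Let $D$ be a division ring with infinite center $F$, and let $n\geq 1$ be an integer. Assume that one of the following conditions holds: (i) $D$ is an algebraic division ring of characteristic zero; (ii) $D$ is finite-dimensional over $F$, where $\operatorname{char}(F)=p>0$, and $p$ divides neither $\sqrt{\dim_F D}$ nor $n$. If $f\in F\langle\mathcal{X}\rangle$ is a nonzero noncommutative polynomial that is neither a polynomial identity nor a central polynomial of $\mathrm{M}_n(D)$, then $$\mathrm{M}_n(D) = Z(\mathrm{M}_n(D)) + \mathrm{span}\, f(\mathrm{M}_n(D)).$$
   Context: $\mathrm{M}_n(D)$ is the $F$-algebra of $n\times n$ matrices over $D$ and $Z(\cdot)$ denotes the center. A division ring $D$ is called algebraic if every element of $D$ satisfies a nonzero polynomial with coefficients in the center of $D$. When $D$ is finite-dimensional over its center $F$, $\dim_F D$ is a perfect square. $F\langle\mathcal{X}\rangle$ is the free unital associative $F$-algebra on $\mathcal{X}=\{x_1,x_2,\ldots\}$ (noncommutative polynomials). For a unital associative $F$-algebra $A$ and $f=f(x_1,\ldots,x_m)\in F\langle\mathcal{X}\rangle$, the image of $f$ on $A$ is $f(A)=\{f(a_1,\ldots,a_m)\mid a_1,\ldots,a_m\in A\}$, and $\mathrm{span}\,f(A)$ is its $F$-linear span. A nonzero $f\in F\langle\mathcal{X}\rangle$ is a polynomial identity of $A$ if $f(A)=\{0\}$. $f$ is a central polynomial of $A$ if $f(A)\subseteq Z(A)$ but $f$ is not identically zero on $A$. *)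

theory Defs
  imports "HOL-Analysis.Analysis" "HOL-Library.Poly_Mapping"
    "HOL-Computational_Algebra.Computational_Algebra"
begin

definition center_wrt :: "('a \<Rightarrow> 'a \<Rightarrow> 'a) \<Rightarrow> 'a set" where
  "center_wrt m = {z. \<forall>x. m z x = m x z}"

text \<open>
  The center \<open>F\<close> of a division ring \<open>D\<close> is made a type of its own, so that it can be an
  instance of class \<^class>\<open>field\<close> and serve as the scalar type of vector spaces.
\<close>

typedef (overloaded) 'd center = "center_wrt ((*) :: 'd::division_ring \<Rightarrow> 'd \<Rightarrow> 'd)"
  morphisms of_center to_center
  by (rule exI[of _ 0]) (simp add: center_wrt_def)

lemma of_center_commute: "of_center c * x = x * of_center c"
  using of_center[of c] unfolding center_wrt_def by blast

lemma add_in_center_wrt: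
  fixes a b :: "'d::division_ring"
  assumes "a \<in> center_wrt (*)" "b \<in> center_wrt (*)"
  shows "a + b \<in> center_wrt (*)"
  using assms unfolding center_wrt_def mem_Collect_eq by (metis distrib_left distrib_right)

lemma uminus_in_center_wrt:
  fixes a :: "'d::division_ring"
  assumes "a \<in> center_wrt (*)"
  shows "- a \<in> center_wrt (*)"
  using assms unfolding center_wrt_def mem_Collect_eq by (metis mult_minus_left mult_minus_right)

lemma diff_in_center_wrt:
  fixes a b :: "'d::division_ring"
  assumes "a \<in> center_wrt (*)" "b \<in> center_wrt (*)"
  shows "a - b \<in> center_wrt (*)"
  using assms unfolding center_wrt_def mem_Collect_eq
  by (metis left_diff_distrib right_diff_distrib)

lemma mult_in_center_wrt:
  fixes a b :: "'d::division_ring"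
  assumes "a \<in> center_wrt (*)" "b \<in> center_wrt (*)"
  shows "a * b \<in> center_wrt (*)"
  using assms unfolding center_wrt_def mem_Collect_eq by (metis mult.assoc)

lemma inverse_in_center_wrt:
  fixes a :: "'d::division_ring"
  assumes "a \<in> center_wrt (*)"
  shows "inverse a \<in> center_wrt (*)"
proof (cases "a = 0")
  case False
  have "inverse a * x = x * inverse a" for x
  proof -
    have "inverse a * x = inverse a * (x * a) * inverse a"
      using False by (simp add: mult.assoc)
    also have "x * a = a * x"
      using assms unfolding center_wrt_def by simp
    also have "inverse a * (a * x) * inverse a = x * inverse a"
      using False by (simp add: mult.assoc [symmetric])
    finally show ?thesis .
  qed
  then show ?thesis
    unfolding center_wrt_def by blast
qed (simp add: center_wrt_def)

instantiation center :: (division_ring) field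
begin

definition "0 = to_center 0"
definition "1 = to_center 1"
definition "a + b = to_center (of_center a + of_center b)"
definition "- a = to_center (- of_center a)"
definition "a - b = to_center (of_center a - of_center b)"
definition "a * b = to_center (of_center a * of_center b)"
definition "inverse a = to_center (inverse (of_center a))"
definition "a div b = to_center (of_center a * inverse (of_center b))"

lemma of_center_simps [simp]:
  "of_center (0 :: 'a center) = 0"
  "of_center (1 :: 'a center) = 1"
  "of_center (a + b :: 'a center) = of_center a + of_center b"
  "of_center (- a :: 'a center) = - of_center a"
  "of_center (a - b :: 'a center) = of_center a - of_center b"
  "of_center (a * b :: 'a center) = of_center a * of_center b"
  "of_center (inverse a :: 'a center) = inverse (of_center a)"
  "of_center (a div b :: 'a center) = of_center a * inverse (of_center b)"
proof -
  note c = of_center[of a] of_center[of b]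
  show "of_center (0 :: 'a center) = 0" "of_center (1 :: 'a center) = 1"
    by (simp_all add: zero_center_def one_center_def to_center_inverse center_wrt_def)
  show "of_center (a + b) = of_center a + of_center b" "of_center (- a) = - of_center a"
    "of_center (a - b) = of_center a - of_center b"
    unfolding plus_center_def uminus_center_def minus_center_def
    by (intro to_center_inverse add_in_center_wrt uminus_in_center_wrt diff_in_center_wrt c)+
  show "of_center (a * b) = of_center a * of_center b"
    "of_center (inverse a) = inverse (of_center a)"
    "of_center (a div b) = of_center a * inverse (of_center b)"
    unfolding times_center_def inverse_center_def divide_center_def
    by (intro to_center_inverse mult_in_center_wrt inverse_in_center_wrt c)+
qed

instance
proof
  fix a b c :: "'a center"
  show "a * b = b * a"
    unfolding of_center_inject [symmetric] of_center_simps by (rule of_center_commute)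
qed (simp_all add: of_center_inject [symmetric] algebra_simps)

end

definition center_scale :: "'d::division_ring center \<Rightarrow> 'd \<Rightarrow> 'd" where
  "center_scale c x = of_center c * x"

lemma vector_space_center_scale: "vector_space center_scale"
  by standard (simp_all add: center_scale_def algebra_simps)

definition mat_center_scale ::
  "'d::division_ring center \<Rightarrow> 'd^'n^'m \<Rightarrow> 'd^'n^'m" where
  "mat_center_scale c A = (\<chi> i j. of_center c * A $ i $ j)"

lemma vector_space_mat_center_scale: "vector_space mat_center_scale"
  by standard (simp_all add: mat_center_scale_def vec_eq_iff algebra_simps)

text \<open>
  Evaluating a polynomial \<open>p\<close> of type \<^typ>\<open>'d center poly\<close> at \<open>x\<close> is spelled out, as
  \<^const>\<open>poly\<close> is only available for commutative rings.
\<close>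

definition algebraic_division_ring :: "'d::division_ring itself \<Rightarrow> bool" where
  "algebraic_division_ring _ \<longleftrightarrow>
     (\<forall>x::'d. \<exists>p::'d center poly. p \<noteq> 0 \<and>
        (\<Sum>i\<le>degree p. of_center (coeff p i) * x ^ i) = 0)"

definition fin_dim_over_center :: "'d::division_ring itself \<Rightarrow> bool" where
  "fin_dim_over_center _ \<longleftrightarrow>
     (\<exists>B::'d set. finite B \<and> module.span center_scale B = UNIV)"

definition dim_over_center :: "'d::division_ring itself \<Rightarrow> nat" where
  "dim_over_center _ = vector_space.dim center_scale (UNIV :: 'd set)"

text \<open>
  A noncommutative polynomial over \<open>F\<close> is a finitely supported family of coefficients indexed
  by words; the word \<open>[i\<^sub>1, \<dots>, i\<^sub>k]\<close> stands for the monomial \<open>x\<^bsub>i\<^sub>1\<^esub> \<cdots> x\<^bsub>i\<^sub>k\<^esub>\<close>, where the variables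
  are numbered from 0. It is evaluated at a sequence of matrices, of which only the finitely many
  entries belonging to variables of the polynomial matter.
\<close>

type_synonym 'f ncpoly = "nat list \<Rightarrow>\<^sub>0 'f"

definition mat_word_prod :: "(nat \<Rightarrow> 'd::division_ring^'n^'n) \<Rightarrow> nat list \<Rightarrow> 'd^'n^'n" where
  "mat_word_prod a w = foldr (\<lambda>i M. a i ** M) w (mat 1)"

definition ncpoly_eval ::
  "'d::division_ring center ncpoly \<Rightarrow> (nat \<Rightarrow> 'd^'n^'n) \<Rightarrow> 'd^'n^'n" where
  "ncpoly_eval f a =
     (\<Sum>w\<in>Poly_Mapping.keys f. mat_center_scale (Poly_Mapping.lookup f w) (mat_word_prod a w))"

definition ncpoly_image :: "'d::division_ring center ncpoly \<Rightarrow> ('d^'n^'n) set" where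
  "ncpoly_image f = range (ncpoly_eval f)"

definition mat_center :: "('d::division_ring^'n^'n) set" where
  "mat_center = center_wrt (**)"

definition polynomial_identity ::
  "('d::division_ring^'n^'n) itself \<Rightarrow> 'd center ncpoly \<Rightarrow> bool" where
  "polynomial_identity _ f \<longleftrightarrow> f \<noteq> 0 \<and> ncpoly_image f = {0 :: 'd^'n^'n}"

definition central_polynomial ::
  "('d::division_ring^'n^'n) itself \<Rightarrow> 'd center ncpoly \<Rightarrow> bool" where
  "central_polynomial _ f \<longleftrightarrow>
     ncpoly_image f \<subseteq> (mat_center :: ('d^'n^'n) set) \<and> (\<exists>a. ncpoly_eval f a \<noteq> (0 :: 'd^'n^'n))"

end

theory Submission
  imports Defs
begin

text \<open>
  Write \<open>A\<close> for the ring of \<open>n \<times> n\<close> matrices over \<open>D\<close> and \<open>V\<close> for the span of the values of \<open>f\<close> on \<open>A\<close>.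
  The proof shows \<open>[A, A] \<subseteq> V\<close> and then \<open>A = Z(A) + [A, A]\<close>.
  
  \<^item> \<open>V\<close> is a Lie ideal (\<open>span_image_commutator\<close>). For fixed matrices \<open>a\<^sub>i\<close> and \<open>b\<close>, the value of \<open>f\<close>
    at \<open>a\<^sub>i + t [a\<^sub>i, b]\<close> is a polynomial in the central parameter \<open>t\<close> with matrix coefficients. As \<open>F\<close> is
    infinite, all these coefficients lie in \<open>V\<close>, and the coefficient of \<open>t\<close> is \<open>[f(a), b]\<close>, since
    \<open>[_, b]\<close> is a derivation.
  
  \<^item> By Herstein's theorem a noncentral Lie ideal of a simple ring contains all commutators, apart from
    exceptions in characteristic 2 (\<open>noncentral_lie_ideal_contains_commutators\<close>). These
    do not occur here because a nonzero central matrix over a finite-dimensional \<open>D\<close> is not a commutator: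
    a trace with values in \<open>F\<close> takes the value \<open>n dim\<^sub>F D \<noteq> 0\<close> at the identity (\<open>central_commutator_zero\<close>).
  
  \<^item> \<open>D = F + [D, D]\<close>. If \<open>D\<close> is finite-dimensional, the functionals that vanish on \<open>[D, D]\<close> are the
    multiples of the trace of the regular representation (\<open>tracial_functional_unique\<close>), whose value
    at 1 is \<open>dim\<^sub>F D \<noteq> 0\<close>; hence no nonzero one vanishes on \<open>F\<close> as well. If \<open>D\<close> is algebraic, let \<open>a\<close> have
    degree \<open>m\<close> over \<open>F\<close>. By Wedderburn the minimal polynomial of \<open>a\<close> is a product of \<open>m\<close> linear factors
    \<open>t - b\<^sub>i\<close> over \<open>D\<close> with \<open>b\<^sub>i\<close> conjugate to \<open>a\<close>. So the sum of the \<open>b\<^sub>i\<close> lies in \<open>F\<close>, and conjugates differ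
    by commutators, which gives \<open>m a \<in> F + [D, D]\<close> (\<open>degree_times_algebraic_element\<close>).
  
  \<^item> Modulo commutators every matrix is diagonal, and \<open>d e\<^sub>i\<^sub>i\<close> and \<open>d e\<^sub>j\<^sub>j\<close> agree. Thus \<open>n d e\<^sub>i\<^sub>i\<close>
    agrees with the scalar matrix \<open>d\<close>, which lies in \<open>Z(A) + [A, A]\<close> by the previous point, and \<open>n\<close> is
    invertible in \<open>F\<close> (\<open>matrix_ring_center_plus_commutators\<close>).
\<close>


section \<open>Lie ideals of a simple ring\<close>

context ring_1
begin

definition lie_ideal :: "'a set \<Rightarrow> bool" where
  "lie_ideal U \<longleftrightarrow>
     0 \<in> U \<and> (\<forall>x\<in>U. \<forall>y\<in>U. x - y \<in> U) \<and> (\<forall>u\<in>U. \<forall>r. u * r - r * u \<in> U)"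

lemma lie_ideal_uminus: "lie_ideal U \<Longrightarrow> x \<in> U \<Longrightarrow> - x \<in> U"
  unfolding lie_ideal_def by (metis diff_0)

lemma lie_ideal_add: "lie_ideal U \<Longrightarrow> x \<in> U \<Longrightarrow> y \<in> U \<Longrightarrow> x + y \<in> U"
  using lie_ideal_uminus[of U y] unfolding lie_ideal_def by (metis diff_minus_eq_add)

lemma commutator_mult: "x * y * r - r * (x * y) = (x * (y * r) - y * r * x) + (y * (r * x) - r * x * y)"
  by (simp add: algebra_simps)

text \<open>
  That the normalizer of a Lie ideal is a subring is what brings the multiplication of the ring into play;
  it rests on the identity \<open>[xy, r] = [x, yr] + [y, rx]\<close>.
\<close>

lemma lie_ideal_normalizer:
  assumes U: "lie_ideal U"
  defines "T \<equiv> {x. \<forall>r. x * r - r * x \<in> U}"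
  shows "lie_ideal T" "U \<subseteq> T" "\<And>x y. x \<in> T \<Longrightarrow> y \<in> T \<Longrightarrow> x * y \<in> T"
proof -
  show UT: "U \<subseteq> T"
    using U unfolding T_def lie_ideal_def by blast
  have "x - y \<in> T" if "x \<in> T" "y \<in> T" for x y
  proof -
    have "(x - y) * r - r * (x - y) = (x * r - r * x) - (y * r - r * y)" for r
      by (simp add: algebra_simps)
    then show ?thesis
      using that U unfolding T_def lie_ideal_def by simp
  qed
  moreover have "x * r - r * x \<in> T" if "x \<in> T" for x r
    using that UT unfolding T_def by blast
  moreover have "0 \<in> T"
    using UT U unfolding lie_ideal_def by blast
  ultimately show "lie_ideal T"
    unfolding lie_ideal_def by blast
  show "x * y \<in> T" if "x \<in> T" "y \<in> T" for x y
    using that lie_ideal_add[OF U] unfolding T_def mem_Collect_eq commutator_mult by blast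
qed

text \<open>
  Expanding \<open>[x, yr] = [x, y] r + y [x, r]\<close> gives \<open>[x, y] r \<in> T\<close> for all \<open>r\<close>. Taking the commutator of
  \<open>[x, y] b\<close> with \<open>a\<close> then moves \<open>a\<close> to the left side.
\<close>

lemma noncommutative_lie_subring_contains_ideal:
  assumes T: "lie_ideal T" and mult: "\<And>x y. x \<in> T \<Longrightarrow> y \<in> T \<Longrightarrow> x * y \<in> T"
    and xy: "x \<in> T" "y \<in> T"
  shows "a * (x * y - y * x) * b \<in> T"
proof -
  have right: "(x * y - y * x) * r \<in> T" for r
  proof -
    have "x * (y * r) - y * r * x \<in> T" "y * (x * r - r * x) \<in> T"
      using T mult xy unfolding lie_ideal_def by blast+
    then have "(x * (y * r) - y * r * x) - y * (x * r - r * x) \<in> T"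
      using T unfolding lie_ideal_def by blast
    also have "(x * (y * r) - y * r * x) - y * (x * r - r * x) = (x * y - y * x) * r"
      by (simp add: algebra_simps)
    finally show ?thesis .
  qed
  have "(x * y - y * x) * (b * a) - ((x * y - y * x) * b * a - a * ((x * y - y * x) * b)) \<in> T"
    using T right[of b] right[of "b * a"] unfolding lie_ideal_def by blast
  then show ?thesis
    by (simp add: algebra_simps)
qed

text \<open>
  For a derivation \<open>\<delta>\<close> with \<open>\<delta>\<^sup>2 = 0\<close>, Leibniz' rule gives \<open>0 = \<delta>\<^sup>2 (r s) = 2 \<delta>(r) \<delta>(s)\<close>. The assumption says
  \<open>[u, [u, r]] = 0\<close>, so that this applies to \<open>\<delta> = [u, _]\<close>.
\<close>

lemma commutator_square_zero:
  assumes uu: "\<And>r. u * u * r - (u * r * u + u * r * u) + r * u * u = 0"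
  shows "(u * r - r * u) * (u * s - s * u) + (u * r - r * u) * (u * s - s * u) = 0"
proof -
  define \<delta> where "\<delta> r = u * r - r * u" for r
  have leib: "\<delta> (x * y) = \<delta> x * y + x * \<delta> y" for x y
    by (simp add: \<delta>_def algebra_simps)
  have add: "\<delta> (x + y) = \<delta> x + \<delta> y" for x y
    by (simp add: \<delta>_def algebra_simps)
  have sq: "\<delta> (\<delta> x) = 0" for x
    using uu[of x] by (simp add: \<delta>_def algebra_simps)
  have "0 = \<delta> (\<delta> (r * s))"
    by (simp add: sq)
  also have "\<dots> = \<delta> r * \<delta> s + \<delta> r * \<delta> s"
    by (simp add: leib add sq)
  finally show ?thesis
    by (simp add: \<delta>_def)
qed

text \<open>
  If the normalizer \<open>T\<close> of \<open>U\<close> is not commutative, it contains a nonzero ideal, so it is the whole ring,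
  which is the claim. If \<open>T\<close> is commutative, every \<open>u \<in> T\<close> commutes with \<open>[u, s]\<close>, and this forces \<open>u\<close> to be
  central. Without 2-torsion, \<open>d = [u, r]\<close> satisfies \<open>d s d = 0\<close> for all \<open>s\<close>. In characteristic 2 squares of
  elements of \<open>T\<close> are central, and the square of \<open>[v, s]\<close> is the commutator \<open>[v, [v, s] s]\<close>, hence zero by
  the assumption on central commutators; applied to \<open>v = u\<close> and to \<open>v = d\<close> this gives \<open>d s d s d = 0\<close>.
\<close>

theorem noncentral_lie_ideal_contains_commutators:
  assumes U: "lie_ideal U" and u: "u \<in> U" "u * r \<noteq> r * u"
    and simple: "\<And>c I. c \<noteq> 0 \<Longrightarrow> lie_ideal I \<Longrightarrow> (\<And>a b. a * c * b \<in> I) \<Longrightarrow> I = UNIV"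
    and prime: "\<And>y. (\<And>s. y * s * y * s * y = 0) \<Longrightarrow> y = 0"
    and char: "(\<forall>x. x + x = 0 \<longrightarrow> x = 0) \<or>
      (\<forall>x. x + x = 0) \<and>
      (\<forall>x y. (\<forall>t. (x * y - y * x) * t = t * (x * y - y * x)) \<longrightarrow> x * y - y * x = 0)"
  shows "x * y - y * x \<in> U"
proof -
  define T where "T = {x. \<forall>r. x * r - r * x \<in> U}"
  note T = lie_ideal_normalizer[OF U, folded T_def]
  have "\<exists>x\<in>T. \<exists>y\<in>T. x * y - y * x \<noteq> 0"
  proof (rule ccontr)
    assume "\<not> ?thesis"
    then have comm: "x * y = y * x" if "x \<in> T" "y \<in> T" for x y
      using that by auto
    have comm': "v * (v * s - s * v) = (v * s - s * v) * v" if "v \<in> T" for v s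
      using T(1) that by (intro comm) (auto simp: lie_ideal_def)
    have uT: "u \<in> T"
      using u T(2) by blast
    define d where "d = u * r - r * u"
    have "d \<noteq> 0"
      using u unfolding d_def by simp
    have dT: "d \<in> T"
      using T(1) uT unfolding lie_ideal_def d_def by blast
    from char show False
    proof
      assume two: "\<forall>x. x + x = 0 \<longrightarrow> x = 0"
      have prod: "d * (u * s - s * u) = 0" for s
      proof -
        have "u * u * s - (u * s * u + u * s * u) + s * u * u = 0" for s
          using comm'[OF uT, of s] by (simp add: algebra_simps)
        then show ?thesis
          using two commutator_square_zero[of u] unfolding d_def by blast
      qed
      have "d * s * d = 0" for s
      proof -
        \<comment> \<open>Leibniz for \<open>[u, s r]\<close>; both terms on the right contain a product that vanishes.\<close>
        have "d * s * d = d * (u * (s * r) - s * r * u) - d * (u * s - s * u) * r"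
          unfolding d_def by (simp add: algebra_simps)
        then show ?thesis
          by (simp only: prod) simp
      qed
      then have "d = 0"
        using prime[of d] by simp
      with \<open>d \<noteq> 0\<close> show False by contradiction
    next
      assume *: "(\<forall>x. x + x = 0) \<and>
        (\<forall>x y. (\<forall>t. (x * y - y * x) * t = t * (x * y - y * x)) \<longrightarrow> x * y - y * x = 0)"
      then have two: "x + x = 0" for x by blast
      then have neg: "- x = x" for x
        by (simp add: neg_eq_iff_add_eq_0)
      have sq_central: "v * v * t = t * (v * v)" if "v \<in> T" for v t
      proof -
        have "v * v * t - t * (v * v) = v * (v * t - t * v) + (v * t - t * v) * v"
          by (simp add: algebra_simps)
        also have "\<dots> = 0"
          by (simp only: comm'[OF that] two)
        finally show ?thesis by simp
      qed
      have sq0: "(v * s - s * v) * (v * s - s * v) = 0" if v: "v \<in> T" for v s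
      proof -
        let ?y = "v * s - s * v"
        have yT: "?y \<in> T"
          using T(1) v unfolding lie_ideal_def by blast
        have "?y * ?y = v * (?y * s) - ?y * s * v"
        proof -
          have "v * (?y * s) - ?y * s * v = v * ?y * s - ?y * s * v"
            by (simp only: mult.assoc)
          also have "\<dots> = ?y * v * s - ?y * s * v"
            by (simp only: comm'[OF v])
          also have "\<dots> = ?y * ?y"
            by (simp add: algebra_simps)
          finally show ?thesis by simp
        qed
        then show ?thesis
          using * sq_central[OF yT] by metis
      qed
      have "d * s * d * s * d = 0" for s
      proof -
        have "d * d = 0"
          using sq0[OF uT] unfolding d_def .
        then have dd: "d * d * x = 0" for x by simp
        have "0 = d * ((d * s - s * d) * (d * s - s * d))"
          by (simp add: sq0[OF dT])
        also have "\<dots> = d * d * (s * d * s - s * s * d) - d * s * (d * d) * s + d * s * d * s * d"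
          by (simp add: algebra_simps)
        finally show ?thesis
          by (simp add: dd \<open>d * d = 0\<close>)
      qed
      then have "d = 0" by (rule prime)
      with \<open>d \<noteq> 0\<close> show False by contradiction
    qed
  qed
  then obtain a b where ab: "a \<in> T" "b \<in> T" "a * b - b * a \<noteq> 0" by blast
  have "T = UNIV"
    using noncommutative_lie_subring_contains_ideal[OF T(1,3) ab(1,2)] simple[OF ab(3) T(1)]
    by blast
  then show ?thesis
    unfolding T_def by blast
qed

end

section \<open>Separating functionals and coefficients of vector-valued polynomials\<close>

lemma (in vector_space) separating_functional:
  assumes "v \<notin> span S"
  obtains \<phi> where "Vector_Spaces.linear scale (*) \<phi>" "\<And>x. x \<in> S \<Longrightarrow> \<phi> x = 0" "\<phi> v = 1"
proof -
  interpret vector_space_pair scale "(*) :: 'a \<Rightarrow> 'a \<Rightarrow> 'a"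
    by unfold_locales (simp_all add: algebra_simps)
  obtain B where B: "B \<subseteq> S" "independent B" "S \<subseteq> span B"
    by (rule maximal_independent_subset)
  have v: "v \<notin> span B"
    using assms span_mono[OF B(1)] by blast
  obtain \<phi> where \<phi>: "Vector_Spaces.linear scale (*) \<phi>"
      "\<And>x. x \<in> insert v B \<Longrightarrow> \<phi> x = (if x = v then 1 else 0)"
    using linear_independent_extend[OF independent_insertI[OF v B(2)],
        of "\<lambda>x. if x = v then 1 else 0"] by blast
  interpret \<phi>: Vector_Spaces.linear scale "(*)" \<phi> by (rule \<phi>(1))
  have "\<phi> x = 0" if "x \<in> S" for x
  proof (rule \<phi>.eq_0_on_span)
    show "\<phi> b = 0" if "b \<in> B" for b
      using \<phi>(2)[of b] that v span_base by auto
    show "x \<in> span B"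
      using that B(3) by blast
  qed
  then show thesis
    using that[OF \<phi>(1)] \<phi>(2)[of v] by simp
qed

text \<open>
  A functional that vanishes on the span turns the family of values into an ordinary polynomial with
  infinitely many roots.
\<close>

lemma (in vector_space) coefficients_in_span:
  assumes inf: "infinite (UNIV :: 'a set)"
    and val: "\<And>t. (\<Sum>k\<le>N. scale (t ^ k) (c k)) \<in> span S" and "k \<le> N"
  shows "c k \<in> span S"
proof (rule ccontr)
  assume "c k \<notin> span S"
  then obtain \<phi> where \<phi>: "Vector_Spaces.linear scale (*) \<phi>"
      "\<And>x. x \<in> S \<Longrightarrow> \<phi> x = 0" "\<phi> (c k) = 1"
    by (rule separating_functional) blast
  interpret \<phi>: Vector_Spaces.linear scale "(*)" \<phi> by (rule \<phi>(1))
  define p where "p = (\<Sum>k\<le>N. monom (\<phi> (c k)) k)"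
  have "poly p t = 0" for t
  proof -
    have "poly p t = \<phi> (\<Sum>k\<le>N. scale (t ^ k) (c k))"
      by (simp add: p_def poly_sum poly_monom \<phi>.sum \<phi>.scale mult.commute)
    also have "\<dots> = 0"
      using \<phi>(2) val by (rule \<phi>.eq_0_on_span)
    finally show ?thesis .
  qed
  then have "p = 0"
    using inf poly_roots_finite[of p] by auto
  moreover have "coeff p k = 1"
    using \<open>k \<le> N\<close> \<phi>(3) by (simp add: p_def coeff_sum)
  ultimately show False by simp
qed

section \<open>Commutators in a finite-dimensional division ring\<close>

interpretation dvs: vector_space center_scale
  by (rule vector_space_center_scale)

lemma center_scale_mult_left: "center_scale c x * y = center_scale c (x * y)"
  by (simp add: center_scale_def mult.assoc)

lemma center_scale_mult_right: "x * center_scale c y = center_scale c (x * y)"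
proof -
  have "x * (of_center c * y) = (x * of_center c) * y"
    by (simp only: mult.assoc)
  then show ?thesis
    by (simp only: center_scale_def of_center_commute [of c x, symmetric] mult.assoc)
qed

lemma finite_basis_over_center:
  assumes "fin_dim_over_center TYPE('d::division_ring)"
  obtains B :: "'d::division_ring set" where "finite B" "dvs.independent B" "dvs.span B = UNIV"
    "card B = dim_over_center TYPE('d)"
proof -
  obtain C :: "'d set" where C: "finite C" "dvs.span C = UNIV"
    using assms unfolding fin_dim_over_center_def by blast
  obtain B :: "'d set" where B: "dvs.independent B" "UNIV \<subseteq> dvs.span B" "card B = dvs.dim (UNIV :: 'd set)"
    by (rule dvs.basis_exists)
  have "finite B"
    using dvs.independent_span_bound[OF C(1) B(1)] C(2) by simp
  with B show thesis
    using that unfolding dim_over_center_def by blast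
qed

text \<open>
  The trace of the left multiplication by an element, computed in a basis; it is
  tracial like every trace of endomorphisms.
\<close>

lemma regular_trace_exists:
  assumes "fin_dim_over_center TYPE('d::division_ring)"
  obtains \<tau> :: "'d::division_ring \<Rightarrow> 'd center" where "Vector_Spaces.linear center_scale (*) \<tau>"
    "\<And>x y. \<tau> (x * y) = \<tau> (y * x)" "\<tau> 1 = of_nat (dim_over_center TYPE('d))"
proof -
  obtain B :: "'d set" where B: "finite B" "dvs.independent B" "dvs.span B = UNIV"
    "card B = dim_over_center TYPE('d)"
    using assms by (rule finite_basis_over_center)
  define \<rho> where "\<rho> = dvs.representation B"
  have \<rho>_add: "\<rho> (x + y) b = \<rho> x b + \<rho> y b" for x y b
    unfolding \<rho>_def using B by (simp add: dvs.representation_add)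
  have \<rho>_scale: "\<rho> (center_scale c x) b = c * \<rho> x b" for c x b
    unfolding \<rho>_def using B by (simp add: dvs.representation_scale)
  have \<rho>_sum: "\<rho> (\<Sum>i\<in>B. g i) b = (\<Sum>i\<in>B. \<rho> (g i) b)" for g :: "'d \<Rightarrow> 'd" and b
    unfolding \<rho>_def using B by (simp add: dvs.representation_sum)
  have expand: "(\<Sum>b\<in>B. center_scale (\<rho> x b) b) = x" for x
    unfolding \<rho>_def using B by (intro dvs.sum_representation_eq) auto
  define \<tau> where "\<tau> x = (\<Sum>b\<in>B. \<rho> (x * b) b)" for x
  have mult: "\<tau> (x * y) = (\<Sum>b\<in>B. \<Sum>b'\<in>B. \<rho> (y * b) b' * \<rho> (x * b') b)" for x y
  proof -
    have "\<rho> (x * y * b) b = (\<Sum>b'\<in>B. \<rho> (y * b) b' * \<rho> (x * b') b)" for b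
    proof -
      have "x * y * b = x * (\<Sum>b'\<in>B. center_scale (\<rho> (y * b) b') b')"
        by (simp only: expand mult.assoc)
      also have "\<dots> = (\<Sum>b'\<in>B. center_scale (\<rho> (y * b) b') (x * b'))"
        by (simp add: sum_distrib_left center_scale_mult_right)
      finally show ?thesis
        by (simp only: \<rho>_sum \<rho>_scale)
    qed
    then show ?thesis
      unfolding \<tau>_def by simp
  qed
  show thesis
  proof
    show "Vector_Spaces.linear center_scale (*) \<tau>"
      by unfold_locales
        (simp_all add: \<tau>_def algebra_simps \<rho>_add \<rho>_scale sum.distrib sum_distrib_left
          center_scale_mult_left)
    show "\<tau> (x * y) = \<tau> (y * x)" for x y
      unfolding mult by (subst sum.swap) (simp add: mult.commute)
    have "\<tau> 1 = (\<Sum>b\<in>B. 1)"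
      unfolding \<tau>_def \<rho>_def using B(2) by (intro sum.cong) (auto simp: dvs.representation_basis)
    then show "\<tau> 1 = of_nat (dim_over_center TYPE('d))"
      using B(4) by simp
  qed
qed

text \<open>
  The pairing \<open>(d, x) \<mapsto> \<phi>(d x)\<close> is nondegenerate since \<open>D\<close> is a division ring, so every functional has
  the form \<open>x \<mapsto> \<phi>(d x)\<close> for some \<open>d\<close>. Such a functional is tracial only if \<open>\<phi>((dx - xd) y) = 0\<close> for all \<open>x\<close>
  and \<open>y\<close>, that is, if \<open>d\<close> is central.
\<close>

lemma tracial_functional_unique:
  fixes \<phi> \<psi> :: "'d::division_ring \<Rightarrow> 'd center"
  assumes "fin_dim_over_center TYPE('d)"
    and \<phi>: "Vector_Spaces.linear center_scale (*) \<phi>" "\<And>x y. \<phi> (x * y) = \<phi> (y * x)" "\<phi> 1 \<noteq> 0"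
    and \<psi>: "Vector_Spaces.linear center_scale (*) \<psi>" "\<And>x y. \<psi> (x * y) = \<psi> (y * x)"
  obtains c where "\<And>x. \<psi> x = c * \<phi> x"
proof -
  obtain B :: "'d set" where B: "finite B" "dvs.independent B" "dvs.span B = UNIV"
    using assms(1) by (rule finite_basis_over_center)
  interpret fd: finite_dimensional_vector_space center_scale B
    using B by unfold_locales
  interpret \<phi>: Vector_Spaces.linear center_scale "(*)" \<phi> by (rule \<phi>(1))
  interpret \<psi>: Vector_Spaces.linear center_scale "(*)" \<psi> by (rule \<psi>(1))
  have nondeg: "d = 0" if "\<And>x. \<phi> (d * x) = 0" for d
    using that[of "inverse d"] \<phi>(3) by (cases "d = 0") auto
  have ext: "\<phi> (d * x) = \<psi>' x" if "Vector_Spaces.linear center_scale (*) \<psi>'"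
    and "\<And>b. b \<in> B \<Longrightarrow> \<phi> (d * b) = \<psi>' b" for d x \<psi>'
  proof -
    interpret \<psi>': Vector_Spaces.linear center_scale "(*)" \<psi>' by (rule that(1))
    have "x \<in> dvs.span B"
      using B(3) by simp
    then show ?thesis
    proof (induction rule: dvs.span_induct_alt)
      case base
      then show ?case by (simp add: \<phi>.zero \<psi>'.zero)
    next
      case (step c b y)
      then show ?case
        using that(2)
        by (simp add: distrib_left center_scale_mult_right \<phi>.add \<phi>.scale \<psi>'.add \<psi>'.scale)
    qed
  qed
  have coords: "\<And>b. b \<in> B \<Longrightarrow> u b = w b"
    if eq: "(\<Sum>b\<in>B. center_scale (u b) b) = (\<Sum>b\<in>B. center_scale (w b) b)" for u w
  proof -
    fix b assume "b \<in> B"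
    have "(\<Sum>b\<in>B. center_scale (u b - w b) b) = 0"
      using eq by (simp add: dvs.scale_left_diff_distrib sum_subtractf)
    then show "u b = w b"
      using dvs.independentD[OF B(2,1) subset_refl _ \<open>b \<in> B\<close>, of "\<lambda>b. u b - w b"] by simp
  qed
  \<comment> \<open>The functional \<open>\<phi>(d _)\<close> is encoded by its values on the basis, as a vector with these coordinates;
    then injectivity of an endomorphism yields its surjectivity.\<close>
  define \<Psi> where "\<Psi> d = (\<Sum>b\<in>B. center_scale (\<phi> (d * b)) b)" for d
  have lin: "Vector_Spaces.linear center_scale center_scale \<Psi>"
    by unfold_locales
      (simp_all add: \<Psi>_def distrib_right \<phi>.add \<phi>.scale center_scale_mult_left
        dvs.scale_left_distrib sum.distrib dvs.scale_sum_right)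
  interpret \<Psi>: Vector_Spaces.linear center_scale center_scale \<Psi> by (rule lin)
  have "inj \<Psi>"
    unfolding \<Psi>.inj_iff_eq_0
  proof (intro allI impI)
    fix d assume "\<Psi> d = 0"
    then have "\<And>b. b \<in> B \<Longrightarrow> \<phi> (d * b) = 0"
      using coords[of "\<lambda>b. \<phi> (d * b)" "\<lambda>_. 0"] by (simp add: \<Psi>_def)
    moreover have "Vector_Spaces.linear center_scale (*) (\<lambda>_::'d. 0 :: 'd center)"
      by unfold_locales (auto simp: algebra_simps)
    ultimately show "d = 0"
      using nondeg ext[of "\<lambda>_. 0" d] by simp
  qed
  then have "surj \<Psi>"
    using fd.linear_inj_imp_surj lin by blast
  then obtain d where d: "(\<Sum>b\<in>B. center_scale (\<psi> b) b) = \<Psi> d"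
    by (rule surjE)
  have d: "\<phi> (d * x) = \<psi> x" for x
    by (rule ext[OF \<psi>(1)], rule coords) (use d in \<open>simp_all add: \<Psi>_def\<close>)
  have "d * x = x * d" for x
  proof -
    have "\<phi> ((d * x - x * d) * y) = 0" for y
    proof -
      have "\<phi> (d * x * y) = \<psi> (y * x)"
        using d[of "x * y"] \<psi>(2)[of x y] by (simp add: mult.assoc)
      also have "\<dots> = \<phi> (x * d * y)"
        using d[of "y * x"] \<phi>(2)[of "d * y" x] by (simp add: mult.assoc)
      finally show ?thesis
        by (simp add: left_diff_distrib \<phi>.diff)
    qed
    then show ?thesis
      using nondeg[of "d * x - x * d"] by simp
  qed
  then obtain c where c: "d = of_center c"
    using of_center_cases[of d] unfolding center_wrt_def by blast
  show thesis
  proof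
    show "\<psi> x = c * \<phi> x" for x
      using d[of x] \<phi>.scale[of c x] by (simp add: c center_scale_def)
  qed
qed

lemma fin_dim_center_plus_commutators:
  assumes fd: "fin_dim_over_center TYPE('d::division_ring)"
    and dim: "of_nat (dim_over_center TYPE('d)) \<noteq> (0 :: 'd center)"
  shows "dvs.span (range of_center \<union> {x * y - y * x | x y. True}) = (UNIV :: 'd set)"
proof (rule ccontr)
  let ?S = "range of_center \<union> {x * y - y * x | x y. True} :: 'd set"
  assume "dvs.span ?S \<noteq> UNIV"
  then obtain v where "v \<notin> dvs.span ?S" by blast
  then obtain \<psi> where \<psi>: "Vector_Spaces.linear center_scale (*) \<psi>"
      "\<And>x. x \<in> ?S \<Longrightarrow> \<psi> x = 0" "\<psi> v = 1"
    by (rule dvs.separating_functional) blast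
  interpret \<psi>: Vector_Spaces.linear center_scale "(*)" \<psi> by (rule \<psi>(1))
  have tr: "\<psi> (x * y) = \<psi> (y * x)" for x y
    using \<psi>(2)[of "x * y - y * x"] by (auto simp: \<psi>.diff)
  have "\<psi> 1 = 0"
    using rangeI[of of_center "1 :: 'd center"] by (intro \<psi>(2)) simp
  obtain \<tau> :: "'d \<Rightarrow> 'd center" where \<tau>: "Vector_Spaces.linear center_scale (*) \<tau>"
    "\<And>x y. \<tau> (x * y) = \<tau> (y * x)" "\<tau> 1 = of_nat (dim_over_center TYPE('d))"
    using regular_trace_exists[OF fd] by blast
  have "\<tau> 1 \<noteq> 0"
    using \<tau>(3) dim by simp
  then obtain c where c: "\<And>x. \<psi> x = c * \<tau> x"
    using tracial_functional_unique[OF fd \<tau>(1,2) _ \<psi>(1) tr] by blast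
  then have "c = 0"
    using c[of 1] \<open>\<psi> 1 = 0\<close> \<open>\<tau> 1 \<noteq> 0\<close> by simp
  then show False
    using c[of v] \<psi>(3) by simp
qed

section \<open>Commutators in an algebraic division ring of characteristic zero\<close>

text \<open>
  A polynomial with coefficients \<open>g\<^sub>i\<close> in \<open>D\<close> is represented here by the operator \<open>u \<mapsto> \<Sum> g\<^sub>i u a\<^sup>i\<close>; the operator
  vanishes iff the polynomial vanishes at all conjugates of \<open>a\<close>. If some coefficient fails to commute with
  \<open>d\<close>, the coefficients \<open>[d, g\<^sub>i]\<close> give a polynomial of smaller degree with the same property, as \<open>g\<close> is
  monic. So at the least degree the coefficients are central, and \<open>u = 1\<close> shows that \<open>a\<close> is a root.
\<close>

lemma sandwich_annihilator_degree:
  fixes a :: "'d::division_ring"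
  assumes minimal: "\<And>c k. c k = 1 \<Longrightarrow> (\<Sum>i\<le>k. of_center (c i) * a ^ i) = 0 \<Longrightarrow> m \<le> k"
    and "g k = 1" and "\<And>u. (\<Sum>i\<le>k. g i * u * a ^ i) = 0"
  shows "m \<le> k"
  using assms(2,3)
proof (induction k arbitrary: g rule: less_induct)
  case (less k)
  show ?case
  proof (cases "\<forall>i\<le>k. g i \<in> center_wrt (*)")
    case True
    define c where "c i = to_center (g i)" for i
    have c: "of_center (c i) = g i" if "i \<le> k" for i
      using True that unfolding c_def by (simp add: to_center_inverse)
    show ?thesis
    proof (rule minimal)
      show "c k = 1"
        using less.prems(1) by (simp add: c_def one_center_def)
      show "(\<Sum>i\<le>k. of_center (c i) * a ^ i) = 0"
        using less.prems(2)[of 1] c by simp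
    qed
  next
    case False
    then obtain i0 where "i0 \<le> k" "g i0 \<notin> center_wrt (*)" by blast
    then obtain d where i0: "i0 \<le> k" "g i0 * d \<noteq> d * g i0"
      unfolding center_wrt_def by blast
    define g' where "g' i = d * g i - g i * d" for i
    define j where "j = Max {i \<in> {..k}. g' i \<noteq> 0}"
    have ne: "{i \<in> {..k}. g' i \<noteq> 0} \<noteq> {}"
      using i0 unfolding g'_def by auto
    have "j \<in> {i \<in> {..k}. g' i \<noteq> 0}"
      unfolding j_def using ne by (intro Max_in) auto
    then have j: "j \<le> k" "g' j \<noteq> 0" by auto
    have above: "g' i = 0" if "i \<le> k" "i > j" for i
    proof (rule ccontr)
      assume "g' i \<noteq> 0"
      then have "i \<le> j"
        unfolding j_def using that by (intro Max_ge) auto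
      with that show False by simp
    qed
    have "j < k"
    proof -
      have "g' k = 0"
        using less.prems(1) by (simp add: g'_def)
      with j have "j \<noteq> k" by auto
      with j show ?thesis by simp
    qed
    moreover have "m \<le> j"
    proof (rule less.IH[OF \<open>j < k\<close>, of "\<lambda>i. inverse (g' j) * g' i"])
      show "inverse (g' j) * g' j = 1"
        using j by simp
      fix u
      have "(\<Sum>i\<le>j. g' i * u * a ^ i) = (\<Sum>i\<le>k. g' i * u * a ^ i)"
        using j above by (intro sum.mono_neutral_left) auto
      also have "\<dots> = d * (\<Sum>i\<le>k. g i * u * a ^ i) - (\<Sum>i\<le>k. g i * (d * u) * a ^ i)"
        by (simp add: g'_def sum_distrib_left sum_subtractf algebra_simps)
      also have "\<dots> = 0"
        by (simp only: less.prems(2)) simp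
      finally show "(\<Sum>i\<le>j. inverse (g' j) * g' i * u * a ^ i) = 0"
        by (simp add: mult.assoc flip: sum_distrib_left)
    qed
    ultimately show ?thesis by simp
  qed
qed

lemma power_intertwine_diff:
  fixes a b w :: "'d::ring_1"
  shows "w * a ^ i - b ^ i * w = (\<Sum>j=0..<i. b ^ (i - Suc j) * (w * a - b * w) * a ^ j)"
proof (induction i)
  case (Suc i)
  have "w * a ^ Suc i - b ^ Suc i * w = b * (w * a ^ i - b ^ i * w) + (w * a - b * w) * a ^ i"
    by (simp add: algebra_simps)
  also have "b * (w * a ^ i - b ^ i * w) = (\<Sum>j=0..<i. b ^ (Suc i - Suc j) * (w * a - b * w) * a ^ j)"
    unfolding Suc.IH sum_distrib_left
    by (intro sum.cong refl) (simp add: mult.assoc [symmetric] Suc_diff_Suc flip: power_Suc)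
  finally show ?case by simp
qed simp

text \<open>
  Division by a linear factor: if \<open>b\<close> is a right root of \<open>h\<close>, then \<open>h = h' (t - b)\<close>. In terms of operators,
  \<open>t - b\<close> acts as \<open>w \<mapsto> w a - b w\<close>.
\<close>

lemma right_linear_factor:
  fixes a b w :: "'d::ring_1"
  assumes root: "(\<Sum>j\<le>k. h j * b ^ j) = 0"
  shows "(\<Sum>j\<le>k. h j * w * a ^ j) =
         (\<Sum>j<k. (\<Sum>i=Suc j..k. h i * b ^ (i - Suc j)) * (w * a - b * w) * a ^ j)"
proof -
  have "(\<Sum>j\<le>k. h j * w * a ^ j) = (\<Sum>j\<le>k. h j * w * a ^ j) - (\<Sum>j\<le>k. h j * b ^ j) * w"
    by (simp add: root)
  also have "\<dots> = (\<Sum>i\<le>k. h i * (w * a ^ i - b ^ i * w))"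
    by (simp add: sum_distrib_right sum_subtractf algebra_simps)
  also have "\<dots> = (\<Sum>i=0..k. \<Sum>j=0..<i. h i * (b ^ (i - Suc j) * (w * a - b * w) * a ^ j))"
    by (simp only: power_intertwine_diff sum_distrib_left atLeast0AtMost)
  also have "\<dots> = (\<Sum>j=0..<k. \<Sum>i=Suc j..k. h i * (b ^ (i - Suc j) * (w * a - b * w) * a ^ j))"
    by (rule sum.nested_swap)
  finally show ?thesis
    by (simp add: sum_distrib_right mult.assoc atLeast0LessThan)
qed

text \<open>
  Multiplying the polynomial \<open>g\<close> by \<open>t - b\<close> on the left composes its operator with \<open>w \<mapsto> w a - b w\<close>.
\<close>

lemma left_linear_factor:
  fixes a b u :: "'d::ring_1"
  shows "(\<Sum>i\<le>Suc n. ((if i = 0 then 0 else g (i - 1)) - (if i \<le> n then b * g i else 0)) * u * a ^ i) =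
         (\<Sum>i\<le>n. g i * u * a ^ i) * a - b * (\<Sum>i\<le>n. g i * u * a ^ i)"
proof -
  have "(\<Sum>i\<le>Suc n. (if i = 0 then 0 else g (i - 1)) * u * a ^ i) = (\<Sum>i\<le>n. g i * u * a ^ i) * a"
    unfolding sum.atMost_Suc_shift by (simp add: sum_distrib_right mult.assoc power_commutes)
  moreover have "(\<Sum>i\<le>Suc n. (if i \<le> n then b * g i else 0) * u * a ^ i) =
      b * (\<Sum>i\<le>n. g i * u * a ^ i)"
    by (simp add: sum_distrib_left mult.assoc)
  ultimately show ?thesis
    by (simp only: left_diff_distrib sum_subtractf)
qed

lemma conjugate_diff_commutator:
  fixes a v :: "'d::division_ring"
  assumes "v \<noteq> 0"
  shows "v * a * inverse v - a \<in> {x * y - y * x | x y. True}"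
proof -
  have "v * a * inverse v - a = (v * a) * inverse v - inverse v * (v * a)"
    using assms by (simp add: mult.assoc [symmetric])
  then show ?thesis by blast
qed

text \<open>
  Wedderburn's factorization of the minimal polynomial of \<open>a\<close>. After \<open>n\<close> steps it is written as \<open>h g\<close>
  with \<open>g\<close> a product of \<open>n\<close> linear factors \<open>t - b\<close>, where each \<open>b\<close> is a conjugate of \<open>a\<close>. As \<open>g\<close> has degree
  less than \<open>m\<close>, its operator takes a nonzero value \<open>v\<close>, and then \<open>v a v\<^sup>-\<^sup>1\<close> is a root of \<open>h\<close>, which splits off
  the next factor. The induction keeps track of the coefficient of \<open>h\<close> below the leading one: it is
  the corresponding coefficient of the minimal polynomial plus the conjugates split off so far, hence
  congruent to \<open>n a\<close> modulo \<open>F + [D, D]\<close>. The process stops with \<open>h\<close> of degree one, where its constant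
  coefficient is also minus a conjugate of \<open>a\<close>.
\<close>

lemma degree_times_algebraic_element:
  fixes a :: "'d::division_ring"
  defines "S \<equiv> dvs.span (range of_center \<union> {x * y - y * x | x y. True})"
  assumes c: "c m = 1" "(\<Sum>i\<le>m. of_center (c i) * a ^ i) = 0"
    and minimal: "\<And>c k. c k = 1 \<Longrightarrow> (\<Sum>i\<le>k. of_center (c i) * a ^ i) = 0 \<Longrightarrow> m \<le> k"
  shows "of_nat m * a \<in> S"
proof -
  have m: "m > 0"
    using c by (cases m) auto
  have conj: "v * a * inverse v - a \<in> S" if "v \<noteq> 0" for v
    unfolding S_def using conjugate_diff_commutator[OF that] by (intro dvs.span_base) blast
  have nonzero: "\<exists>u. (\<Sum>i\<le>n. g i * u * a ^ i) \<noteq> 0" if "n < m" "g n = 1" for n g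
    using sandwich_annihilator_degree[OF minimal, where g = g and k = n] that by force
  have "\<exists>h g. h (m - n) = 1 \<and> g n = 1 \<and>
      (\<forall>u. (\<Sum>j\<le>m - n. h j * (\<Sum>i\<le>n. g i * u * a ^ i) * a ^ j) = 0) \<and>
      h (m - Suc n) - of_nat n * a \<in> S" if "n < m" for n
    using that
  proof (induction n)
    case 0
    have "(\<Sum>j\<le>m. of_center (c j) * u * a ^ j) = u * (\<Sum>j\<le>m. of_center (c j) * a ^ j)" for u
      by (simp add: sum_distrib_left of_center_commute mult.assoc)
    then have "(\<Sum>j\<le>m. of_center (c j) * u * a ^ j) = 0" for u
      using c(2) by simp
    moreover have "of_center (c (m - 1)) \<in> S"
      unfolding S_def by (intro dvs.span_base) blast
    ultimately show ?case
      using c(1) by (intro exI[of _ "\<lambda>j. of_center (c j)"] exI[of _ "\<lambda>_. 1"]) simp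
  next
    case (Suc n)
    define k where "k = m - n"
    have k: "k \<ge> 2" "m - Suc n = k - 1" "m - Suc (Suc n) = k - 2"
      using Suc.prems unfolding k_def by auto
    obtain h g where hg: "h k = 1" "g n = 1" "h (k - 1) - of_nat n * a \<in> S"
      "\<And>u. (\<Sum>j\<le>k. h j * (\<Sum>i\<le>n. g i * u * a ^ i) * a ^ j) = 0"
      using Suc unfolding k_def by force
    define G where "G u = (\<Sum>i\<le>n. g i * u * a ^ i)" for u
    obtain u where u: "G u \<noteq> 0"
      using nonzero[of n g] Suc.prems hg(2) unfolding G_def by auto
    define v where "v = G u"
    define b where "b = v * a * inverse v"
    have "b * v = v * a"
      using u unfolding b_def v_def by (simp add: mult.assoc)
    have "b ^ j * v = v * a ^ j" for j
    proof (induction j)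
      case (Suc j)
      have "b ^ Suc j * v = b * (b ^ j * v)"
        by (simp add: mult.assoc)
      also have "\<dots> = (b * v) * a ^ j"
        by (simp only: Suc mult.assoc)
      also have "\<dots> = v * a ^ Suc j"
        by (simp add: \<open>b * v = v * a\<close> mult.assoc)
      finally show ?case .
    qed simp
    then have "(\<Sum>j\<le>k. h j * b ^ j) * v = (\<Sum>j\<le>k. h j * v * a ^ j)"
      by (simp add: sum_distrib_right mult.assoc)
    also have "\<dots> = 0"
      using hg(4)[of u] unfolding v_def G_def .
    finally have root: "(\<Sum>j\<le>k. h j * b ^ j) = 0"
      using u unfolding v_def by simp
    define h' where "h' j = (\<Sum>i=Suc j..k. h i * b ^ (i - Suc j))" for j
    define g' where "g' i = (if i = 0 then 0 else g (i - 1)) - (if i \<le> n then b * g i else 0)" for i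
    have "h' (k - 1) = 1"
      using k hg(1) by (simp add: h'_def)
    moreover have "g' (Suc n) = 1"
      by (simp add: g'_def hg(2))
    moreover have "(\<Sum>j\<le>k - 1. h' j * (\<Sum>i\<le>Suc n. g' i * w * a ^ i) * a ^ j) = 0" for w
    proof -
      have "(\<Sum>i\<le>Suc n. g' i * w * a ^ i) = G w * a - b * G w"
        unfolding g'_def G_def by (rule left_linear_factor)
      moreover have "{..k - 1} = {..<k}"
        using k by auto
      ultimately have "(\<Sum>j\<le>k - 1. h' j * (\<Sum>i\<le>Suc n. g' i * w * a ^ i) * a ^ j) =
          (\<Sum>j<k. h' j * (G w * a - b * G w) * a ^ j)"
        by simp
      also have "\<dots> = (\<Sum>j\<le>k. h j * G w * a ^ j)"
        unfolding h'_def by (rule right_linear_factor[OF root, symmetric])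
      also have "\<dots> = 0"
        using hg(4) unfolding G_def .
      finally show ?thesis .
    qed
    moreover have "h' (k - 2) - of_nat (Suc n) * a \<in> S"
    proof -
      have "{Suc (k - 2)..k} = {k - 1, k}"
        using k by auto
      moreover have "k - Suc (k - 2) = 1"
        using k by simp
      ultimately have "h' (k - 2) = h (k - 1) + b"
        using k hg(1) unfolding h'_def by (simp add: Suc_diff_Suc numeral_2_eq_2)
      then have "h' (k - 2) - of_nat (Suc n) * a = (h (k - 1) - of_nat n * a) + (b - a)"
        by (simp add: algebra_simps)
      also have "\<dots> \<in> S"
        using hg(3) conj[of v] u unfolding S_def b_def v_def by (intro dvs.span_add)
      finally show ?thesis .
    qed
    ultimately show ?case
      unfolding k(2,3) by blast
  qed
  from this[of "m - 1"] m obtain h g where hg: "h 1 = 1" "g (m - 1) = 1"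
    "h 0 - of_nat (m - 1) * a \<in> S"
    "\<And>u. (\<Sum>j\<le>1. h j * (\<Sum>i\<le>m - 1. g i * u * a ^ i) * a ^ j) = 0"
    by auto
  obtain u where u: "(\<Sum>i\<le>m - 1. g i * u * a ^ i) \<noteq> 0"
    using nonzero[of "m - 1" g] m hg(2) by auto
  define v where "v = (\<Sum>i\<le>m - 1. g i * u * a ^ i)"
  have "h 0 * v + v * a = 0"
    using hg(4)[of u] hg(1) by (simp add: v_def)
  then have "h 0 * v * inverse v = - (v * a) * inverse v"
    by (metis eq_neg_iff_add_eq_0)
  then have "h 0 = - (v * a * inverse v)"
    using u by (simp add: v_def mult.assoc)
  then have "of_nat m * a = - (h 0 - of_nat (m - 1) * a) - (v * a * inverse v - a)"
    using m by (cases m) (simp_all add: algebra_simps)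
  also have "\<dots> \<in> S"
    using hg(3) conj[of v] u unfolding S_def v_def by (intro dvs.span_diff[OF dvs.span_neg])
  finally show ?thesis .
qed

lemma of_center_of_nat [simp]: "of_center (of_nat n) = of_nat n"
  by (induction n) simp_all

lemma CHAR_center: "CHAR('d::division_ring center) = CHAR('d)"
proof (rule CHAR_eqI)
  show "of_nat CHAR('d) = (0 :: 'd center)"
    by (simp flip: of_center_inject)
  show "CHAR('d) dvd n" if "of_nat n = (0 :: 'd center)" for n
    using arg_cong[OF that, of of_center] by (simp add: of_nat_eq_0_iff_char_dvd)
qed

lemma algebraic_center_plus_commutators:
  assumes "algebraic_division_ring TYPE('d::division_ring)" and "CHAR('d) = 0"
  shows "dvs.span (range of_center \<union> {x * y - y * x | x y. True}) = (UNIV :: 'd set)"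
proof (intro subset_antisym subset_UNIV subsetI)
  fix a :: 'd
  let ?S = "dvs.span (range of_center \<union> {x * y - y * x | x y. True}) :: 'd set"
  define P where "P m \<longleftrightarrow> (\<exists>c. c m = 1 \<and> (\<Sum>i\<le>m. of_center (c i) * a ^ i) = 0)" for m
  obtain p :: "'d center poly" where p: "p \<noteq> 0"
    "(\<Sum>i\<le>degree p. of_center (coeff p i) * a ^ i) = 0"
    using assms(1) unfolding algebraic_division_ring_def by blast
  have "P (degree p)"
    unfolding P_def
  proof (intro exI[of _ "\<lambda>i. inverse (lead_coeff p) * coeff p i"] conjI)
    show "inverse (lead_coeff p) * lead_coeff p = 1"
      using p(1) by simp
    show "(\<Sum>i\<le>degree p. of_center (inverse (lead_coeff p) * coeff p i) * a ^ i) = 0"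
      using p(2) by (simp add: mult.assoc flip: sum_distrib_left)
  qed
  define m where "m = (LEAST m. P m)"
  have "P m"
    unfolding m_def using \<open>P (degree p)\<close> by (rule LeastI)
  then obtain c where c: "c m = 1" "(\<Sum>i\<le>m. of_center (c i) * a ^ i) = 0"
    unfolding P_def by blast
  have min: "m \<le> k" if "c k = 1" "(\<Sum>i\<le>k. of_center (c i) * a ^ i) = 0" for c k
    unfolding m_def using that by (intro Least_le) (auto simp: P_def)
  have "m > 0"
    using c by (cases m) auto
  then have "of_nat m \<noteq> (0 :: 'd)" and "of_nat m \<noteq> (0 :: 'd center)"
    using assms(2) by (simp_all add: of_nat_eq_0_iff_char_dvd CHAR_center)
  have "center_scale (inverse (of_nat m)) (of_nat m * a) \<in> ?S"
    by (intro dvs.span_scale degree_times_algebraic_element[OF c min])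
  also have "center_scale (inverse (of_nat m)) (of_nat m * a) = a"
    using \<open>of_nat m \<noteq> (0 :: 'd)\<close> by (simp add: center_scale_def flip: mult.assoc)
  finally show "a \<in> ?S" .
qed

section \<open>Matrices over a division ring\<close>

(* Formal power series use the same symbol, which would make every matrix entry ambiguous. *)
no_notation fps_nth (infixl \<open>$\<close> 75)

interpretation mvs: vector_space mat_center_scale
  by (rule vector_space_mat_center_scale)

lemma mat_center_scale_mult_left: "mat_center_scale c A ** B = mat_center_scale c (A ** B)"
  by (simp add: mat_center_scale_def matrix_matrix_mult_def vec_eq_iff sum_distrib_left mult.assoc)

lemma mat_center_scale_mult_right: "A ** mat_center_scale c B = mat_center_scale c (A ** B)"
proof -
  have "x * (of_center c * y) = of_center c * (x * y)" for x y :: 'a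
    using center_scale_mult_right[of x c y] by (simp only: center_scale_def)
  then show ?thesis
    by (simp add: mat_center_scale_def matrix_matrix_mult_def vec_eq_iff sum_distrib_left)
qed

lemma matrix_diff_ldistrib: "A ** (B - C) = A ** B - A ** (C :: 'a::ring_1^'n^'m)"
  by (simp add: matrix_matrix_mult_def vec_eq_iff right_diff_distrib sum_subtractf)

lemma matrix_diff_rdistrib: "(A - B) ** C = A ** C - (B :: 'a::ring_1^'n^'m) ** C"
  by (simp add: matrix_matrix_mult_def vec_eq_iff left_diff_distrib sum_subtractf)

lemma matrix_add_rdistrib: "(A + B) ** C = A ** C + (B :: 'a::semiring_1^'n^'m) ** C"
  by (simp add: matrix_matrix_mult_def vec_eq_iff distrib_right sum.distrib)

lemma matrix_mult_zero_left [simp]: "(0 :: 'a::semiring_1^'n^'m) ** A = 0"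
  by (simp add: matrix_matrix_mult_def vec_eq_iff)

lemma matrix_mult_zero_right [simp]: "A ** (0 :: 'a::semiring_1^'n^'m) = 0"
  by (simp add: matrix_matrix_mult_def vec_eq_iff)

definition matrix_unit :: "'n \<Rightarrow> 'm \<Rightarrow> 'a::zero \<Rightarrow> 'a^'m^'n" where
  "matrix_unit i j d = (\<chi> k l. if k = i \<and> l = j then d else 0)"

lemma mult_matrix_unit:
  "(A ** matrix_unit i j d) $ k $ l = (if l = j then A $ k $ i * d else (0 :: 'a::semiring_1))"
  by (cases "l = j")
    (simp_all add: matrix_matrix_mult_def matrix_unit_def if_distrib sum.delta cong: if_cong)

lemma matrix_unit_mult:
  "(matrix_unit i j d ** A) $ k $ l = (if k = i then d * A $ j $ l else (0 :: 'a::semiring_1))"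
  by (cases "k = i")
    (simp_all add: matrix_matrix_mult_def matrix_unit_def if_distrib [of "\<lambda>x. x * _"] sum.delta
      cong: if_cong)

lemma matrix_unit_mult_matrix_unit:
  "matrix_unit i j d ** matrix_unit k l e =
     (if j = k then matrix_unit i l (d * e) else (0 :: 'a::semiring_1^'m^'n))"
  by (auto simp: vec_eq_iff mult_matrix_unit) (auto simp: matrix_unit_def)

lemma matrix_unit_sandwich:
  "matrix_unit k i d ** A ** matrix_unit j l e = matrix_unit k l (d * A $ i $ j * (e :: 'a::semiring_1))"
  by (auto simp: vec_eq_iff mult_matrix_unit matrix_unit_mult) (auto simp: matrix_unit_def)

lemma matrix_eq_sum_matrix_units:
  "A = (\<Sum>i\<in>UNIV. \<Sum>j\<in>UNIV. matrix_unit i j (A $ i $ j :: 'a::comm_monoid_add))"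
proof -
  have "(\<Sum>i\<in>UNIV. \<Sum>j\<in>UNIV. matrix_unit i j (A $ i $ j) $ k $ l) = A $ k $ l" for k l
  proof -
    have "(\<Sum>j\<in>UNIV. matrix_unit i j (A $ i $ j) $ k $ l) = (if k = i then A $ i $ l else 0)" for i
      by (cases "k = i") (simp_all add: matrix_unit_def)
    then show ?thesis by simp
  qed
  then show ?thesis
    by (simp add: vec_eq_iff)
qed

lemma two_sided_ideal_matrix:
  fixes c :: "'d::division_ring^'n^'n"
  assumes "c \<noteq> 0" and "(0 :: 'd^'n^'n) \<in> I" and add: "\<And>x y. x \<in> I \<Longrightarrow> y \<in> I \<Longrightarrow> x + y \<in> I"
    and sandwich: "\<And>a b. a ** c ** b \<in> I"
  shows "I = UNIV"
proof -
  obtain i j where ij: "c $ i $ j \<noteq> 0"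
    using \<open>c \<noteq> 0\<close> by (auto simp: vec_eq_iff)
  have units: "matrix_unit k l d \<in> I" for k l d
    using sandwich[of "matrix_unit k i (d * inverse (c $ i $ j))" "matrix_unit j l 1"] ij
    by (simp add: matrix_unit_sandwich mult.assoc)
  have sums: "sum g S \<in> I" if "\<And>s. g s \<in> I" for S and g :: "'n \<Rightarrow> 'd^'n^'n"
    using that \<open>0 \<in> I\<close> add by (induction S rule: infinite_finite_induct) auto
  have "A \<in> I" for A
  proof -
    have "(\<Sum>i\<in>UNIV. \<Sum>j\<in>UNIV. matrix_unit i j (A $ i $ j)) \<in> I"
      by (intro sums units)
    then show ?thesis
      by (simp only: matrix_eq_sum_matrix_units [of A, symmetric])
  qed
  then show ?thesis by blast
qed

text \<open>
  For a nonzero entry \<open>c\<close> of \<open>y\<close> at \<open>(i, j)\<close>, the matrix \<open>s = c\<^sup>-\<^sup>1 e\<^sub>j\<^sub>i\<close> satisfies \<open>s y s = s\<close>, so no product of alternating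
  factors \<open>s\<close> and \<open>y\<close> vanishes.
\<close>

lemma matrix_ring_semiprime:
  fixes y :: "'d::division_ring^'n^'n"
  assumes "\<And>s. y ** s ** y ** s ** y = 0"
  shows "y = 0"
proof (rule ccontr)
  assume "y \<noteq> 0"
  then obtain i j where ij: "y $ i $ j \<noteq> 0"
    by (auto simp: vec_eq_iff)
  define s where "s = matrix_unit j i (inverse (y $ i $ j))"
  have "s ** y ** s = s"
    using ij by (simp add: s_def matrix_unit_sandwich)
  then have "y ** s ** y = y ** s ** y ** s ** y"
    by (metis matrix_mul_assoc)
  then have "s ** (y ** s ** y) ** s = 0"
    using assms by simp
  moreover have "s ** (y ** s ** y) ** s = s"
    using \<open>s ** y ** s = s\<close> by (metis matrix_mul_assoc)
  ultimately have "s $ j $ i = 0" by simp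
  with ij show False
    by (simp add: s_def matrix_unit_def)
qed

lemma mat_of_center: "mat (of_center c) = mat_center_scale c (mat 1)"
  by (simp add: mat_def mat_center_scale_def vec_eq_iff)

lemma mat_of_center_central: "mat (of_center c) \<in> mat_center"
  unfolding mat_center_def center_wrt_def mat_of_center
  by (simp add: mat_center_scale_mult_left mat_center_scale_mult_right)

lemma mat_center_eq_scalar:
  assumes Z: "Z \<in> (mat_center :: ('d::division_ring^'n^'n) set)"
  obtains c where "Z = mat (of_center c)"
proof -
  have comm: "(Z ** matrix_unit i j d) $ k $ l = (matrix_unit i j d ** Z) $ k $ l" for i j d k l
    using Z unfolding mat_center_def center_wrt_def by simp
  have diag: "Z $ i $ i * d = d * Z $ j $ j" for i j d
    using comm[of i j d i j] by (simp add: mult_matrix_unit matrix_unit_mult)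
  have off: "Z $ k $ i = 0" if "k \<noteq> i" for k i
    using comm[of i i 1 k i] that by (simp add: mult_matrix_unit matrix_unit_mult)
  fix i :: 'n
  have "Z $ i $ i \<in> center_wrt (*)"
    using diag[of i _ i] unfolding center_wrt_def by simp
  then obtain c where c: "Z $ i $ i = of_center c"
    by (metis of_center_cases)
  have "Z $ k $ l = (if k = l then of_center c else 0)" for k l
    using off[of k l] diag[of k 1 i] c by (cases "k = l") simp_all
  then have "Z = mat (of_center c)"
    by (simp add: vec_eq_iff mat_def)
  then show thesis by (rule that)
qed

text \<open>
  Composing the matrix trace with the regular trace of \<open>D\<close> gives a functional that kills commutators and
  has the value \<open>n dim\<^sub>F D\<close> at the identity.
\<close>

lemma central_commutator_zero:
  fixes x y :: "'d::division_ring^'n^'n"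
  assumes fd: "fin_dim_over_center TYPE('d)"
    and dim: "of_nat (dim_over_center TYPE('d)) \<noteq> (0 :: 'd center)"
    and n: "of_nat CARD('n) \<noteq> (0 :: 'd center)"
    and central: "x ** y - y ** x \<in> mat_center"
  shows "x ** y - y ** x = 0"
proof -
  obtain \<tau> :: "'d \<Rightarrow> 'd center" where \<tau>: "Vector_Spaces.linear center_scale (*) \<tau>"
    "\<And>x y. \<tau> (x * y) = \<tau> (y * x)" "\<tau> 1 = of_nat (dim_over_center TYPE('d))"
    using regular_trace_exists[OF fd] by blast
  interpret \<tau>: Vector_Spaces.linear center_scale "(*)" \<tau> by (rule \<tau>(1))
  obtain c where c: "x ** y - y ** x = mat (of_center c)"
    using mat_center_eq_scalar[OF central] by blast
  have "(\<Sum>i\<in>UNIV. \<tau> ((x ** y) $ i $ i)) = (\<Sum>i\<in>UNIV. \<Sum>j\<in>UNIV. \<tau> (x $ i $ j * y $ j $ i))"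
    by (simp add: matrix_matrix_mult_def \<tau>.sum)
  also have "\<dots> = (\<Sum>j\<in>UNIV. \<Sum>i\<in>UNIV. \<tau> (y $ j $ i * x $ i $ j))"
    by (subst sum.swap) (simp add: \<tau>(2))
  also have "\<dots> = (\<Sum>i\<in>UNIV. \<tau> ((y ** x) $ i $ i))"
    by (simp add: matrix_matrix_mult_def \<tau>.sum)
  finally have "0 = (\<Sum>i\<in>UNIV. \<tau> ((x ** y - y ** x) $ i $ i))"
    by (simp add: \<tau>.diff sum_subtractf)
  also have "\<dots> = of_nat CARD('n) * \<tau> (center_scale c 1)"
    unfolding c by (simp add: mat_def center_scale_def)
  finally have "c = 0"
    using n dim \<tau>(3) by (simp add: \<tau>.scale)
  then show ?thesis
    unfolding c by (simp add: mat_def vec_eq_iff)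
qed

text \<open>
  The product of the ring of matrices is \<open>**\<close>, while \<open>*\<close> on this type acts entry by entry; hence the
  theorem on Lie ideals is transferred by interpreting \<^class>\<open>ring_1\<close> as a locale.
\<close>

lemma noncentral_matrix_lie_ideal:
  fixes U :: "('d::division_ring^'n^'n) set"
  assumes U: "0 \<in> U" "\<And>x y. x \<in> U \<Longrightarrow> y \<in> U \<Longrightarrow> x - y \<in> U"
      "\<And>u r. u \<in> U \<Longrightarrow> u ** r - r ** u \<in> U"
    and u: "u \<in> U" "u \<notin> mat_center"
    and char: "CHAR('d) \<noteq> 2 \<or>
      (\<forall>x y :: 'd^'n^'n. x ** y - y ** x \<in> mat_center \<longrightarrow> x ** y - y ** x = 0)"
  shows "x ** y - y ** x \<in> U"
proof -
  have one_neq_zero: "(0 :: 'd^'n^'n) \<noteq> mat 1"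
    by (simp add: mat_def vec_eq_iff)
  interpret mr: ring_1 where one = "mat 1 :: 'd^'n^'n" and times = "(**)" and plus = "(+)"
    and zero = 0 and minus = "(-)" and uminus = uminus
    by unfold_locales
      (simp_all add: matrix_mul_assoc matrix_add_ldistrib matrix_add_rdistrib one_neq_zero)
  obtain r where r: "u ** r \<noteq> r ** u"
    using u(2) unfolding mat_center_def center_wrt_def by blast
  show ?thesis
  proof (rule mr.noncentral_lie_ideal_contains_commutators[OF _ u(1) r])
    show "mr.lie_ideal U"
      using U unfolding mr.lie_ideal_def by blast
    show "I = UNIV" if "c \<noteq> 0" "mr.lie_ideal I" "\<And>a b. a ** c ** b \<in> I"
      for c :: "'d^'n^'n" and I
    proof (rule two_sided_ideal_matrix[OF that(1) _ mr.lie_ideal_add[OF that(2)] that(3)])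
      show "0 \<in> I"
        using that(2) unfolding mr.lie_ideal_def by blast
    qed
    show "y = 0" if "\<And>s. y ** s ** y ** s ** y = 0" for y :: "'d^'n^'n"
      using that by (rule matrix_ring_semiprime)
    have double: "x + x = of_nat 2 * x" for x :: 'd
      by (simp add: mult_2)
    show "(\<forall>x :: 'd^'n^'n. x + x = 0 \<longrightarrow> x = 0) \<or>
      (\<forall>x :: 'd^'n^'n. x + x = 0) \<and>
      (\<forall>x y :: 'd^'n^'n. (\<forall>t. (x ** y - y ** x) ** t = t ** (x ** y - y ** x)) \<longrightarrow> x ** y - y ** x = 0)"
    proof (cases "CHAR('d) = 2")
      case True
      then have "CHAR('d) dvd 2" by simp
      then have "(of_nat 2 :: 'd) = 0"
        by (simp only: of_nat_eq_0_iff_char_dvd)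
      then have "x + x = 0" for x :: 'd
        by (simp only: double mult_zero_left)
      then have "x + x = 0" for x :: "'d^'n^'n"
        by (simp only: vec_eq_iff vector_add_component zero_index simp_thms)
      moreover have "\<forall>x y :: 'd^'n^'n. x ** y - y ** x \<in> mat_center \<longrightarrow> x ** y - y ** x = 0"
        using True char by blast
      ultimately show ?thesis
        unfolding mat_center_def center_wrt_def mem_Collect_eq by blast
    next
      case False
      have "\<not> CHAR('d) dvd 2"
        using False CHAR_not_1[where 'a = 'd] two_is_prime_nat by (auto simp: prime_nat_iff)
      then have "(of_nat 2 :: 'd) \<noteq> 0"
        by (simp only: of_nat_eq_0_iff_char_dvd not_False_eq_True)
      then have entry: "x + x = 0 \<longleftrightarrow> x = 0" for x :: 'd
        by (simp only: double mult_eq_0_iff simp_thms)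
      have "x + x = 0 \<longleftrightarrow> x = 0" for x :: "'d^'n^'n"
        by (simp only: vec_eq_iff vector_add_component zero_index entry)
      then show ?thesis by blast
    qed
  qed
qed

section \<open>The span of the values of a noncommutative polynomial\<close>

text \<open>
  The coefficient of \<open>t\<^sup>k\<close> in the product of \<open>a\<^sub>i + t \<delta>\<^sub>i\<close> along a word.
\<close>

primrec word_coeff ::
  "(nat \<Rightarrow> 'd::division_ring^'n^'n) \<Rightarrow> (nat \<Rightarrow> 'd^'n^'n) \<Rightarrow> nat list \<Rightarrow> nat \<Rightarrow> 'd^'n^'n" where
  "word_coeff a \<delta> [] k = (if k = 0 then mat 1 else 0)"
| "word_coeff a \<delta> (i # w) k = a i ** word_coeff a \<delta> w k +
     (case k of 0 \<Rightarrow> 0 | Suc k' \<Rightarrow> \<delta> i ** word_coeff a \<delta> w k')"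

lemma word_coeff_0: "word_coeff a \<delta> w 0 = mat_word_prod a w"
  by (induction w) (simp_all add: mat_word_prod_def)

lemma mat_word_prod_translate:
  assumes "length w \<le> N"
  shows "mat_word_prod (\<lambda>i. a i + mat_center_scale t (\<delta> i)) w =
    (\<Sum>k\<le>N. mat_center_scale (t ^ k) (word_coeff a \<delta> w k))"
  using assms
proof (induction w arbitrary: N)
  case Nil
  then show ?case
    by (simp add: mat_word_prod_def if_distrib cong: if_cong)
next
  case (Cons i w)
  then obtain N' where N: "N = Suc N'" "length w \<le> N'"
    by (cases N) auto
  define P where "P = mat_word_prod (\<lambda>i. a i + mat_center_scale t (\<delta> i)) w"
  have sum_mult: "M ** (\<Sum>k\<le>n. g k) = (\<Sum>k\<le>n. M ** g k)" for M :: "'a^'b^'b" and n and g :: "nat \<Rightarrow> 'a^'b^'b"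
    by (induction n) (simp_all add: matrix_add_ldistrib)
  have "(\<Sum>k\<le>N. mat_center_scale (t ^ k) (word_coeff a \<delta> (i # w) k)) =
      (\<Sum>k\<le>N. mat_center_scale (t ^ k) (a i ** word_coeff a \<delta> w k)) +
      (\<Sum>k\<le>N. mat_center_scale (t ^ k) (case k of 0 \<Rightarrow> 0 | Suc k' \<Rightarrow> \<delta> i ** word_coeff a \<delta> w k'))"
    by (simp add: mvs.scale_right_distrib sum.distrib)
  also have "(\<Sum>k\<le>N. mat_center_scale (t ^ k) (a i ** word_coeff a \<delta> w k)) = a i ** P"
    using Cons.IH[of N] N by (simp add: P_def sum_mult mat_center_scale_mult_right del: sum.atMost_Suc)
  also have "(\<Sum>k\<le>N. mat_center_scale (t ^ k) (case k of 0 \<Rightarrow> 0 | Suc k' \<Rightarrow> \<delta> i ** word_coeff a \<delta> w k')) =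
      mat_center_scale t (\<delta> i) ** P"
    unfolding N(1) sum.atMost_Suc_shift using Cons.IH[OF N(2)]
    by (simp add: P_def sum_mult mat_center_scale_mult_right mat_center_scale_mult_left
        mvs.scale_sum_right mult.commute)
  finally show ?case
    by (simp add: mat_word_prod_def P_def matrix_add_rdistrib)
qed

text \<open>
  The coefficient of \<open>t\<close> is the sum of the products in which one factor \<open>a\<^sub>i\<close> is replaced by \<open>\<delta>\<^sub>i\<close>; for
  \<open>\<delta>\<^sub>i = [a\<^sub>i, b]\<close> this is Leibniz' rule for the derivation \<open>[_, b]\<close>.
\<close>

lemma word_coeff_derivation:
  assumes "\<And>i. \<delta> i = a i ** b - b ** a i"
  shows "word_coeff a \<delta> w (Suc 0) = mat_word_prod a w ** b - b ** mat_word_prod a w"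
proof (induction w)
  case Nil
  show ?case by (simp add: mat_word_prod_def)
next
  case (Cons i w)
  have "word_coeff a \<delta> (i # w) (Suc 0) =
      a i ** (mat_word_prod a w ** b - b ** mat_word_prod a w) + (a i ** b - b ** a i) ** mat_word_prod a w"
    by (simp add: Cons assms word_coeff_0)
  also have "\<dots> = (a i ** mat_word_prod a w) ** b - b ** (a i ** mat_word_prod a w)"
    by (simp add: matrix_diff_ldistrib matrix_diff_rdistrib matrix_mul_assoc)
  finally show ?case
    by (simp add: mat_word_prod_def)
qed

text \<open>
  The value of \<open>f\<close> at \<open>a\<^sub>i + t [a\<^sub>i, b]\<close> lies in the span for every \<open>t\<close>, so its coefficient of \<open>t\<close>, which is
  \<open>[f(a), b]\<close>, does as well.
\<close>

lemma span_image_commutator: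
  fixes f :: "'d::division_ring center ncpoly" and b v :: "'d^'n^'n"
  assumes inf: "infinite (UNIV :: 'd center set)"
    and v: "v \<in> mvs.span (ncpoly_image f)"
  shows "v ** b - b ** v \<in> mvs.span (ncpoly_image f)"
proof -
  have image: "ncpoly_eval f a ** b - b ** ncpoly_eval f a \<in> mvs.span (ncpoly_image f)"
    for a :: "nat \<Rightarrow> 'd^'n^'n"
  proof -
    define \<delta> where "\<delta> i = a i ** b - b ** a i" for i
    define K where "K = Poly_Mapping.keys f"
    \<comment> \<open>An upper bound for the lengths of the words; the successor makes room for the coefficient of \<open>t\<close>
      when \<open>f\<close> is constant.\<close>
    define N where "N = Suc (\<Sum>w\<in>K. length w)"
    have N: "length w \<le> N" if "w \<in> K" for w
      using member_le_sum[of w K length] that by (simp add: N_def K_def)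
    define c where "c k = (\<Sum>w\<in>K. mat_center_scale (Poly_Mapping.lookup f w) (word_coeff a \<delta> w k))" for k
    have "(\<Sum>k\<le>N. mat_center_scale (t ^ k) (c k)) =
        ncpoly_eval f (\<lambda>i. a i + mat_center_scale t (\<delta> i))" for t
    proof -
      have "ncpoly_eval f (\<lambda>i. a i + mat_center_scale t (\<delta> i)) =
          (\<Sum>w\<in>K. \<Sum>k\<le>N. mat_center_scale (t ^ k)
            (mat_center_scale (Poly_Mapping.lookup f w) (word_coeff a \<delta> w k)))"
        unfolding ncpoly_eval_def K_def [symmetric]
      proof (intro sum.cong refl)
        fix w assume "w \<in> K"
        then show "mat_center_scale (Poly_Mapping.lookup f w)
            (mat_word_prod (\<lambda>i. a i + mat_center_scale t (\<delta> i)) w) =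
          (\<Sum>k\<le>N. mat_center_scale (t ^ k)
            (mat_center_scale (Poly_Mapping.lookup f w) (word_coeff a \<delta> w k)))"
          by (simp add: mat_word_prod_translate[OF N] mvs.scale_sum_right mult.commute
              del: sum.atMost_Suc)
      qed
      also have "\<dots> = (\<Sum>k\<le>N. mat_center_scale (t ^ k) (c k))"
        unfolding c_def mvs.scale_sum_right by (rule sum.swap)
      finally show ?thesis by simp
    qed
    then have "(\<Sum>k\<le>N. mat_center_scale (t ^ k) (c k)) \<in> mvs.span (ncpoly_image f)" for t
      unfolding ncpoly_image_def by (intro mvs.span_base) simp
    then have "c 1 \<in> mvs.span (ncpoly_image f)"
      by (rule mvs.coefficients_in_span[OF inf]) (simp add: N_def)
    moreover have "c 1 = ncpoly_eval f a ** b - b ** ncpoly_eval f a"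
    proof -
      have sums: "(\<Sum>w\<in>K. g w) ** b = (\<Sum>w\<in>K. g w ** b)" "b ** (\<Sum>w\<in>K. g w) = (\<Sum>w\<in>K. b ** g w)"
        for g :: "nat list \<Rightarrow> 'd^'n^'n"
        by (induction K rule: infinite_finite_induct)
          (simp_all add: matrix_add_ldistrib matrix_add_rdistrib)
      show ?thesis
        unfolding c_def ncpoly_eval_def K_def [symmetric] sums One_nat_def
        by (simp add: word_coeff_derivation[of \<delta> a b] \<delta>_def mvs.scale_right_diff_distrib
            sum_subtractf mat_center_scale_mult_left mat_center_scale_mult_right)
    qed
    ultimately show ?thesis by simp
  qed
  show ?thesis
    using v
  proof (induction rule: mvs.span_induct_alt)
    case base
    show ?case by (simp add: mvs.span_zero)
  next
    case (step c x y)
    then obtain a where "x = ncpoly_eval f a"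
      unfolding ncpoly_image_def by blast
    have "(mat_center_scale c x + y) ** b - b ** (mat_center_scale c x + y) =
        mat_center_scale c (x ** b - b ** x) + (y ** b - b ** y)"
      by (simp add: matrix_add_ldistrib matrix_add_rdistrib mat_center_scale_mult_left
          mat_center_scale_mult_right mvs.scale_right_diff_distrib)
    also have "\<dots> \<in> mvs.span (ncpoly_image f)"
      using image step \<open>x = ncpoly_eval f a\<close> by (intro mvs.span_add mvs.span_scale) simp_all
    finally show ?case .
  qed
qed


section \<open>Matrices modulo the center and commutators\<close>

lemma subspace_mat_center: "mvs.subspace (mat_center :: ('d::division_ring^'n^'n) set)"
  unfolding mvs.subspace_def mat_center_def center_wrt_def
  by (simp add: matrix_add_ldistrib matrix_add_rdistrib mat_center_scale_mult_left
      mat_center_scale_mult_right)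

lemma matrix_ring_center_plus_commutators:
  fixes W :: "('d::division_ring^'n^'n) set"
  assumes D: "dvs.span (range of_center \<union> {x * y - y * x | x y. True}) = (UNIV :: 'd set)"
    and n: "of_nat CARD('n) \<noteq> (0 :: 'd center)"
    and W: "mvs.subspace W" "mat_center \<subseteq> W" "\<And>x y. x ** y - y ** x \<in> W"
  shows "W = UNIV"
proof -
  have mat_add: "mat (x + y) = mat x + (mat y :: 'd^'n^'n)" for x y
    by (simp add: mat_def vec_eq_iff)
  have mat_mult: "mat (x * y) = mat x ** (mat y :: 'd^'n^'n)" for x y
    by (simp add: mat_def matrix_matrix_mult_def vec_eq_iff if_distrib [of "\<lambda>u. u * _"] cong: if_cong)
  have mat_diff: "mat (x - y) = mat x - (mat y :: 'd^'n^'n)" for x y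
    by (simp add: mat_def vec_eq_iff)
  have mat_scale: "mat (center_scale c x) = (mat_center_scale c (mat x) :: 'd^'n^'n)" for c x
    by (simp add: mat_def vec_eq_iff center_scale_def mat_center_scale_def)
  have "dvs.subspace {d. (mat d :: 'd^'n^'n) \<in> W}"
    unfolding dvs.subspace_def
    using W(1) by (simp add: mvs.subspace_def mat_add mat_scale mat_0)
  moreover have "range of_center \<union> {x * y - y * x | x y. True} \<subseteq> {d. (mat d :: 'd^'n^'n) \<in> W}"
    using W(2,3) mat_of_center_central by (auto simp: mat_diff mat_mult)
  ultimately have "dvs.span (range of_center \<union> {x * y - y * x | x y. True}) \<subseteq> {d. (mat d :: 'd^'n^'n) \<in> W}"
    by (intro dvs.span_minimal)
  then have scalar: "mat d \<in> W" for d
    using D by blast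
  have off: "matrix_unit i j d \<in> W" if "i \<noteq> j" for i j d
    using W(3)[of "matrix_unit i i 1" "matrix_unit i j d"] that
    by (simp add: matrix_unit_mult_matrix_unit)
  have diff: "matrix_unit i i d - matrix_unit j j d \<in> W" for i j d
    using W(3)[of "matrix_unit i j d" "matrix_unit j i 1"]
    by (simp add: matrix_unit_mult_matrix_unit)
  have diag: "matrix_unit i i d \<in> W" for i d
  proof -
    \<comment> \<open>Summing over \<open>j\<close> replaces \<open>n\<close> copies of \<open>d\<close> at position \<open>(i, i)\<close> by one copy at each diagonal position.\<close>
    have "(\<Sum>j\<in>UNIV. matrix_unit i i d - matrix_unit j j d) + mat d =
        mat_center_scale (of_nat CARD('n)) (matrix_unit i i d)"
    proof -
      have "matrix_unit j j d $ k $ l = (if j = k then if k = l then d else 0 else 0)"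
        for j k l :: 'n
        by (auto simp: matrix_unit_def)
      then have "(\<Sum>j\<in>UNIV. matrix_unit j j d) = (mat d :: 'd^'n^'n)"
        by (simp add: mat_def vec_eq_iff)
      then show ?thesis
        by (simp add: sum_subtractf mvs.sum_constant_scale del: sum_constant)
    qed
    moreover have "(\<Sum>j\<in>UNIV. matrix_unit i i d - matrix_unit j j d) + mat d \<in> W"
      by (intro mvs.subspace_add[OF W(1)] mvs.subspace_sum[OF W(1)] diff scalar)
    ultimately have "mat_center_scale (of_nat CARD('n)) (matrix_unit i i d) \<in> W"
      by simp
    then have "mat_center_scale (inverse (of_nat CARD('n)))
        (mat_center_scale (of_nat CARD('n)) (matrix_unit i i d)) \<in> W"
      by (rule mvs.subspace_scale[OF W(1)])
    then show ?thesis
      using n by (simp add: mvs.scale_scale)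
  qed
  have "A \<in> W" for A
  proof -
    have "matrix_unit i j (A $ i $ j) \<in> W" for i j
      using off diag by (cases "i = j") auto
    then have "(\<Sum>i\<in>UNIV. \<Sum>j\<in>UNIV. matrix_unit i j (A $ i $ j)) \<in> W"
      using W(1) by (intro mvs.subspace_sum)
    then show ?thesis
      by (simp only: matrix_eq_sum_matrix_units [of A, symmetric])
  qed
  then show ?thesis by blast
qed

theorem theorem2p7:
  fixes f :: "'d::division_ring center ncpoly"
  assumes "infinite (UNIV :: 'd center set)"
    and "(algebraic_division_ring TYPE('d) \<and> CHAR('d) = 0) \<or>
         (fin_dim_over_center TYPE('d) \<and> CHAR('d center) > 0 \<and>
          (\<exists>s. s\<^sup>2 = dim_over_center TYPE('d) \<and> \<not> CHAR('d center) dvd s) \<and>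
          \<not> CHAR('d center) dvd CARD('n::finite))"
    and "f \<noteq> 0"
    and "\<not> polynomial_identity TYPE('d^'n^'n) f"
    and "\<not> central_polynomial TYPE('d^'n^'n) f"
  shows "(UNIV :: ('d^'n^'n) set) =
         {z + s | z s. z \<in> mat_center \<and> s \<in> module.span mat_center_scale (ncpoly_image f)}"
proof -
  define V :: "('d^'n^'n) set" where "V = mvs.span (ncpoly_image f)"
  have conditions: "dvs.span (range of_center \<union> {x * y - y * x | x y. True}) = (UNIV :: 'd set) \<and>
      of_nat CARD('n) \<noteq> (0 :: 'd center) \<and>
      (CHAR('d) \<noteq> 2 \<or>
        (\<forall>x y :: 'd^'n^'n. x ** y - y ** x \<in> mat_center \<longrightarrow> x ** y - y ** x = 0))"
    using assms(2)
  proof (elim disjE conjE exE)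
    assume "algebraic_division_ring TYPE('d)" "CHAR('d) = 0"
    then show ?thesis
      using algebraic_center_plus_commutators by (simp add: of_nat_eq_0_iff_char_dvd CHAR_center)
  next
    fix s
    assume fd: "fin_dim_over_center TYPE('d)" and pos: "CHAR('d center) > 0"
      and s: "s\<^sup>2 = dim_over_center TYPE('d)" "\<not> CHAR('d center) dvd s"
      and n: "\<not> CHAR('d center) dvd CARD('n)"
    have "of_nat s \<noteq> (0 :: 'd center)"
      using s(2) by (simp only: of_nat_eq_0_iff_char_dvd not_False_eq_True)
    then have dim: "of_nat (dim_over_center TYPE('d)) \<noteq> (0 :: 'd center)"
      by (simp flip: s(1))
    have n': "of_nat CARD('n) \<noteq> (0 :: 'd center)"
      using n by (simp only: of_nat_eq_0_iff_char_dvd not_False_eq_True)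
    show ?thesis
      using fin_dim_center_plus_commutators[OF fd dim] n' central_commutator_zero[OF fd dim n']
      by blast
  qed
  obtain u where u: "u \<in> ncpoly_image f" "u \<notin> (mat_center :: ('d^'n^'n) set)"
  proof -
    have "ncpoly_image f \<noteq> {0 :: 'd^'n^'n}"
      using assms(3,4) unfolding polynomial_identity_def by blast
    then have "\<exists>a. ncpoly_eval f a \<noteq> (0 :: 'd^'n^'n)"
      unfolding ncpoly_image_def by auto
    then have "\<not> ncpoly_image f \<subseteq> (mat_center :: ('d^'n^'n) set)"
      using assms(5) unfolding central_polynomial_def by blast
    then show thesis
      using that by blast
  qed
  have commutators: "x ** y - y ** x \<in> V" for x y
  proof (rule noncentral_matrix_lie_ideal[OF _ _ _ _ u(2)])
    show "0 \<in> V" "u \<in> V"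
      unfolding V_def using u(1) by (auto intro: mvs.span_zero mvs.span_base)
    show "x - y \<in> V" if "x \<in> V" "y \<in> V" for x y
      using that unfolding V_def by (rule mvs.span_diff)
    show "v ** r - r ** v \<in> V" if "v \<in> V" for v r
      using span_image_commutator[OF assms(1)] that unfolding V_def .
  qed (use conditions in blast)
  define W where "W = {z + s | z s. z \<in> mat_center \<and> s \<in> V}"
  have "W = UNIV"
  proof (rule matrix_ring_center_plus_commutators)
    show "mvs.subspace W"
      unfolding W_def V_def by (intro mvs.subspace_sums subspace_mat_center mvs.subspace_span)
    have "0 \<in> V" "0 \<in> (mat_center :: ('d^'n^'n) set)"
      using mvs.subspace_0 subspace_mat_center mvs.span_zero unfolding V_def by blast+
    then have W: "z + s \<in> W" if "z \<in> mat_center" "s \<in> V" for z s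
      using that unfolding W_def by blast
    show "mat_center \<subseteq> W"
      using W[OF _ \<open>0 \<in> V\<close>] by auto
    show "x ** y - y ** x \<in> W" for x y
      using W[OF \<open>0 \<in> mat_center\<close> commutators[of x y]] by simp
  qed (use conditions in auto)
  then show ?thesis
    unfolding W_def V_def by simp
qed

end
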